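(* Let $\mathcal{G}$ be a compact simple Lie algebra with basis $\{X_i\}$ and let $\Omega^{(2m-1)}$ be a primitive $(2m-1)$-cocycle on $\mathcal{G}$. Then the element $$\mathcal{C}'^{(m)}=[\Omega^{(2m-1)}]^{j_1\dots j_{2m-1}}X_{j_1}\cdots X_{j_{2m-1}}$$ of the enveloping algebra $\mathcal{U}(\mathcal{G})$ is an $m$-order Casimir operator for $\mathcal{G}$.
   Context: $\mathcal{G}$ is a compact simple real Lie algebra with basis $\{X_i\}_{i=1}^r$, $[X_i,X_j]=C_{ij}^kX_k$; repeated indices are summed. The basis is chosen so that the Killing form is a negative multiple of $\delta_{ij}$, so indices are raised and lowered with $\delta_{ij}$ and $C_{ijk}$ is totally antisymmetric. A Casimir operator of order $m$ is an element of $\mathcal{U}(\mathcal{G})$ of the form $h^{i_1\dots i_m}X_{i_1}\cdots X_{i_m}$, with $h$ a symmetric invariant tensor of order $m$; it commutes with all of $\mathcal{G}$. A tensor $h_{i_1\dots i_m}$ is invariant if $\sum_{s=1}^m C^\rho_{\nu i_s} h_{i_1\dots i_{s-1}\rho i_{s+1}\dots i_m}=0$ for all $\nu,i_1,\dots,i_m$. A symmetric invariant tensor is primitive if it is not a linear combination of symmetrised products of symmetric invariant tensors of lower order. The generalized $\epsilon$ symbol is $\epsilon_{\alpha_1\dots\alpha_n}^{\beta_1\dots\beta_n}=\sum_{\sigma\in S_n}\mathrm{sgn}(\sigma)\,\delta_{\alpha_1}^{\beta_{\sigma(1)}}\cdots\delta_{\alpha_n}^{\beta_{\sigma(n)}}$.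 A primitive $(2m-1)$-cocycle is the skewsymmetric invariant tensor constructed from a primitive symmetric invariant tensor $h$ of order $m$ by $$\Omega^{(2m-1)}_{i_1\dots i_{2m-2}\sigma}=\frac{1}{(2m-1)!}\,\epsilon^{j_1\dots j_{2m-2}\rho}_{i_1\dots i_{2m-2}\sigma}\,C_{j_1j_2}^{l_1}\cdots C_{j_{2m-3}j_{2m-2}}^{l_{m-1}}\,h_{l_1\dots l_{m-1}\rho}.$$ *)

theory Defs
  imports
    Complex_Main
    "HOL-Combinatorics.Permutations"
    "HOL-Library.Poly_Mapping"
begin

section \<open>Real Lie algebras\<close>

class lie_algebra = real_vector +
  fixes lie_bracket :: "'a \<Rightarrow> 'a \<Rightarrow> 'a"
  assumes lie_bracket_add_left: "lie_bracket (x + y) z = lie_bracket x z + lie_bracket y z"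
    and lie_bracket_scaleR_left: "lie_bracket (c *\<^sub>R x) z = c *\<^sub>R lie_bracket x z"
    and lie_bracket_add_right: "lie_bracket z (x + y) = lie_bracket z x + lie_bracket z y"
    and lie_bracket_scaleR_right: "lie_bracket z (c *\<^sub>R x) = c *\<^sub>R lie_bracket z x"
    and lie_bracket_self: "lie_bracket x x = 0"
    and lie_jacobi:
      "lie_bracket x (lie_bracket y z) + lie_bracket y (lie_bracket z x)
         + lie_bracket z (lie_bracket x y) = 0"

definition lie_ideal :: "'g::lie_algebra set \<Rightarrow> bool" where
  "lie_ideal I \<longleftrightarrow> subspace I \<and> (\<forall>x. \<forall>y\<in>I. lie_bracket x y \<in> I)"

definition simple_lie_algebra :: "'g::lie_algebra itself \<Rightarrow> bool" where
  "simple_lie_algebra G \<longleftrightarrow>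
     (\<exists>x y :: 'g. lie_bracket x y \<noteq> 0) \<and>
     (\<forall>I :: 'g set. lie_ideal I \<longrightarrow> I = {0} \<or> I = UNIV)"

text \<open>
  The trace is computed in some basis; by \<open>lin_trace_eq\<close> below the choice does not
  matter in finite dimension.
\<close>

definition lin_trace :: "('v::real_vector \<Rightarrow> 'v) \<Rightarrow> real" where
  "lin_trace f =
     (let B = (SOME B. independent B \<and> span B = UNIV)
      in \<Sum>b\<in>B. representation B (f b) b)"

lemma lin_trace_eq:
  fixes f :: "'v::real_vector \<Rightarrow> 'v"
  assumes f: "linear f" and B: "independent B" "span B = UNIV" "finite B"
  shows "lin_trace f = (\<Sum>b\<in>B. representation B (f b) b)"
proof -
  define A :: "'v set" where "A = (SOME B. independent B \<and> span B = UNIV)"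
  have "independent A \<and> span A = UNIV"
    unfolding A_def by (rule someI[of _ B]) (use B in simp)
  then have A: "independent A" "span A = UNIV" by auto
  have finA: "finite A"
    using independent_span_bound[OF B(3) A(1)] B(2) by auto
  have expandA: "x = (\<Sum>a\<in>A. representation A x a *\<^sub>R a)" for x
    using sum_representation_eq[OF A(1) _ finA order_refl, of x] A(2) by simp
  have expandB: "x = (\<Sum>b\<in>B. representation B x b *\<^sub>R b)" for x
    using sum_representation_eq[OF B(1) _ B(3) order_refl, of x] B(2) by simp
  have reps: "representation C (\<Sum>i\<in>S. c i *\<^sub>R v i) d = (\<Sum>i\<in>S. c i * representation C (v i) d)"
    if "independent C" "span C = UNIV" for C and S :: "'v set" and c and v :: "'v \<Rightarrow> 'v" and d
    using that by (simp add: representation_sum representation_scale)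
  have fx: "f (\<Sum>i\<in>S. c i *\<^sub>R i) = (\<Sum>i\<in>S. c i *\<^sub>R f i)" for S c
    using f by (simp add: linear_sum linear_scale)
  have "lin_trace f = (\<Sum>a\<in>A. representation A (f a) a)"
    unfolding lin_trace_def A_def by (simp add: Let_def)
  also have "\<dots> = (\<Sum>a\<in>A. \<Sum>b\<in>B. representation B a b * representation A (f b) a)"
  proof (rule sum.cong[OF refl])
    fix a assume "a \<in> A"
    have "f a = (\<Sum>b\<in>B. representation B a b *\<^sub>R f b)"
      by (subst expandB[of a], subst fx, rule refl)
    then show "representation A (f a) a = (\<Sum>b\<in>B. representation B a b * representation A (f b) a)"
      by (simp add: reps[OF A])
  qed
  also have "\<dots> = (\<Sum>b\<in>B. \<Sum>a\<in>A. representation A (f b) a * representation B a b)"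
    by (subst sum.swap) (simp add: mult.commute)
  also have "\<dots> = (\<Sum>b\<in>B. representation B (f b) b)"
  proof (rule sum.cong[OF refl])
    fix b assume "b \<in> B"
    have "representation B (f b) b = representation B (\<Sum>a\<in>A. representation A (f b) a *\<^sub>R a) b"
      using expandA[of "f b"] by simp
    then show "(\<Sum>a\<in>A. representation A (f b) a * representation B a b) = representation B (f b) b"
      by (simp add: reps[OF B(1,2)])
  qed
  finally show ?thesis .
qed

definition killing_form :: "'g::lie_algebra \<Rightarrow> 'g \<Rightarrow> real" where
  "killing_form x y = lin_trace (\<lambda>z. lie_bracket x (lie_bracket y z))"

text \<open>
  For a finite-dimensional semisimple algebra, being the Lie algebra of a compact group
  means that the Killing form is negative definite.
\<close>

definition compact_simple_lie_algebra :: "'g::lie_algebra itself \<Rightarrow> bool" where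
  "compact_simple_lie_algebra G \<longleftrightarrow>
     simple_lie_algebra G \<and> (\<forall>x :: 'g. x \<noteq> 0 \<longrightarrow> killing_form x x < 0)"


section \<open>Bases and structure constants\<close>

definition lie_basis :: "('n::finite \<Rightarrow> 'g::lie_algebra) \<Rightarrow> bool" where
  "lie_basis X \<longleftrightarrow> inj X \<and> independent (range X) \<and> span (range X) = UNIV"

definition killing_normalised :: "('n::finite \<Rightarrow> 'g::lie_algebra) \<Rightarrow> bool" where
  "killing_normalised X \<longleftrightarrow>
     (\<exists>c>0. \<forall>i j. killing_form (X i) (X j) = (if i = j then - c else 0))"

text \<open>\<open>structure_const X i j k\<close> is the constant with lower indices \<open>i j\<close> and upper index \<open>k\<close>.\<close>

definition structure_const :: "('n::finite \<Rightarrow> 'g::lie_algebra) \<Rightarrow> 'n \<Rightarrow> 'n \<Rightarrow> 'n \<Rightarrow> real" where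
  "structure_const X i j k = representation (range X) (lie_bracket (X i) (X j)) (X k)"

lemma lie_bracket_structure_const:
  assumes "lie_basis X"
  shows "lie_bracket (X i) (X j) = (\<Sum>k\<in>UNIV. structure_const X i j k *\<^sub>R X k)"
proof -
  have "lie_bracket (X i) (X j) =
      (\<Sum>b\<in>range X. representation (range X) (lie_bracket (X i) (X j)) b *\<^sub>R b)"
    using assms sum_representation_eq[of "range X" "lie_bracket (X i) (X j)" "range X"]
    by (simp add: lie_basis_def)
  also have "\<dots> = (\<Sum>k\<in>UNIV. structure_const X i j k *\<^sub>R X k)"
    using assms by (simp add: lie_basis_def sum.reindex structure_const_def)
  finally show ?thesis .
qed


section \<open>Symmetric invariant tensors\<close>

text \<open>
  A tensor of order \<open>m\<close> is given by its components, indexed by the lists of length \<open>m\<close>;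
  its values on lists of any other length are irrelevant. Indices are raised and lowered
  with the identity matrix, so their position is not recorded.
\<close>

type_synonym 'n tensor = "'n list \<Rightarrow> real"

definition indices :: "nat \<Rightarrow> 'n list set" where
  "indices m = {is. length is = m}"

definition symmetric_tensor :: "nat \<Rightarrow> 'n tensor \<Rightarrow> bool" where
  "symmetric_tensor m h \<longleftrightarrow>
     (\<forall>is\<in>indices m. \<forall>\<pi>. \<pi> permutes {..<m} \<longrightarrow> h (permute_list \<pi> is) = h is)"

definition invariant_tensor ::
    "('n::finite \<Rightarrow> 'g::lie_algebra) \<Rightarrow> nat \<Rightarrow> 'n tensor \<Rightarrow> bool" where
  "invariant_tensor X m h \<longleftrightarrow>
     (\<forall>\<nu>. \<forall>is\<in>indices m.
        (\<Sum>s<m. \<Sum>\<rho>\<in>UNIV. structure_const X \<nu> (is ! s) \<rho> * h (is[s := \<rho>])) = 0)"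

definition sym_invariant_tensor ::
    "('n::finite \<Rightarrow> 'g::lie_algebra) \<Rightarrow> nat \<Rightarrow> 'n tensor \<Rightarrow> bool" where
  "sym_invariant_tensor X m h \<longleftrightarrow> symmetric_tensor m h \<and> invariant_tensor X m h"

definition symmetrise :: "nat \<Rightarrow> 'n tensor \<Rightarrow> 'n tensor" where
  "symmetrise m t is = (\<Sum>\<pi> | \<pi> permutes {..<m}. t (permute_list \<pi> is)) / fact m"

text \<open>Tensor product of a list of tensors, each paired with its order.\<close>

fun tensor_product :: "(nat \<times> 'n tensor) list \<Rightarrow> 'n tensor" where
  "tensor_product [] is = 1"
| "tensor_product ((p, f) # fs) is = f (take p is) * tensor_product fs (drop p is)"

definition decomposable_tensor ::
    "('n::finite \<Rightarrow> 'g::lie_algebra) \<Rightarrow> nat \<Rightarrow> 'n tensor \<Rightarrow> bool" where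
  "decomposable_tensor X m h \<longleftrightarrow>
     (\<exists>F (c :: (nat \<times> 'n tensor) list \<Rightarrow> real). finite F \<and>
        (\<forall>fs\<in>F. sum_list (map fst fs) = m \<and>
           (\<forall>(p, f)\<in>set fs. p < m \<and> sym_invariant_tensor X p f)) \<and>
        (\<forall>is\<in>indices m. h is = (\<Sum>fs\<in>F. c fs * symmetrise m (tensor_product fs) is)))"

definition primitive_tensor ::
    "('n::finite \<Rightarrow> 'g::lie_algebra) \<Rightarrow> nat \<Rightarrow> 'n tensor \<Rightarrow> bool" where
  "primitive_tensor X m h \<longleftrightarrow> sym_invariant_tensor X m h \<and> \<not> decomposable_tensor X m h"


section \<open>Primitive cocycles\<close>

text \<open>Lower indices \<open>\<alpha>\<close>, upper indices \<open>\<beta>\<close>.\<close>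

definition gen_epsilon :: "nat \<Rightarrow> 'n list \<Rightarrow> 'n list \<Rightarrow> real" where
  "gen_epsilon n \<alpha> \<beta> =
     (\<Sum>\<pi> | \<pi> permutes {..<n}. of_int (sign \<pi>) * (\<Prod>k<n. of_bool (\<alpha> ! k = \<beta> ! \<pi> k)))"

text \<open>
  Lists are numbered from 0: the pairs contracted with the structure constants are
  \<open>js ! 0, js ! 1\<close> up to \<open>js ! (2 * m - 4), js ! (2 * m - 3)\<close>, and the index \<open>\<rho>\<close> is
  \<open>js ! (2 * m - 2)\<close>.
\<close>

definition cocycle_of ::
    "('n::finite \<Rightarrow> 'g::lie_algebra) \<Rightarrow> nat \<Rightarrow> 'n tensor \<Rightarrow> 'n tensor" where
  "cocycle_of X m h is =
     (1 / fact (2 * m - 1)) *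
     (\<Sum>js\<in>indices (2 * m - 1). gen_epsilon (2 * m - 1) is js *
        (\<Sum>ls\<in>indices (m - 1).
           (\<Prod>s<m - 1. structure_const X (js ! (2 * s)) (js ! (2 * s + 1)) (ls ! s)) *
           h (ls @ [js ! (2 * m - 2)])))"

definition primitive_cocycle ::
    "('n::finite \<Rightarrow> 'g::lie_algebra) \<Rightarrow> nat \<Rightarrow> 'n tensor \<Rightarrow> bool" where
  "primitive_cocycle X m \<Omega> \<longleftrightarrow>
     (\<exists>h. primitive_tensor X m h \<and> (\<forall>is\<in>indices (2 * m - 1). \<Omega> is = cocycle_of X m h is))"


section \<open>The universal enveloping algebra\<close>

text \<open>
  The free unital associative algebra on the set \<open>'g\<close> is the monoid algebra of the words
  over \<open>'g\<close>. Imposing linearity of the generators turns it into the tensor algebra of the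
  vector space \<open>'g\<close>; imposing in addition the commutator relations gives the universal
  enveloping algebra.
\<close>

datatype 'a free_monoid = Letters "'a list"

instantiation free_monoid :: (type) monoid_add
begin

definition zero_free_monoid :: "'a free_monoid" where
  "0 = Letters []"

fun plus_free_monoid :: "'a free_monoid \<Rightarrow> 'a free_monoid \<Rightarrow> 'a free_monoid" where
  "Letters u + Letters v = Letters (u @ v)"

instance
proof
  fix a b c :: "'a free_monoid"
  show "a + b + c = a + (b + c)" by (cases a; cases b; cases c) simp
  show "0 + a = a" by (cases a) (simp add: zero_free_monoid_def)
  show "a + 0 = a" by (cases a) (simp add: zero_free_monoid_def)
qed

end

type_synonym 'a free_algebra = "'a free_monoid \<Rightarrow>\<^sub>0 real"

definition free_gen :: "'a \<Rightarrow> 'a free_algebra" where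
  "free_gen x = Poly_Mapping.single (Letters [x]) 1"

definition free_scale :: "real \<Rightarrow> 'a free_algebra \<Rightarrow> 'a free_algebra" where
  "free_scale c p = Poly_Mapping.single 0 c * p"

inductive_set uea_ideal :: "'g::lie_algebra free_algebra set" where
  add: "free_gen (x + y) - (free_gen x + free_gen y) \<in> uea_ideal"
| scale: "free_gen (c *\<^sub>R x) - free_scale c (free_gen x) \<in> uea_ideal"
| bracket:
    "free_gen x * free_gen y - free_gen y * free_gen x - free_gen (lie_bracket x y) \<in> uea_ideal"
| zero: "0 \<in> uea_ideal"
| sum: "p \<in> uea_ideal \<Longrightarrow> q \<in> uea_ideal \<Longrightarrow> p + q \<in> uea_ideal"
| left_mult: "p \<in> uea_ideal \<Longrightarrow> a * p \<in> uea_ideal"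
| right_mult: "p \<in> uea_ideal \<Longrightarrow> p * a \<in> uea_ideal"

lemma uea_ideal_uminus: "p \<in> uea_ideal \<Longrightarrow> - p \<in> uea_ideal"
  using uea_ideal.left_mult[of p "- 1"] by simp

definition uea_rel :: "'g::lie_algebra free_algebra \<Rightarrow> 'g free_algebra \<Rightarrow> bool" where
  "uea_rel p q \<longleftrightarrow> p - q \<in> uea_ideal"

quotient_type (overloaded) 'g uea = "'g::lie_algebra free_algebra" / uea_rel
proof (rule equivpI)
  show "reflp (uea_rel :: 'g free_algebra \<Rightarrow> _)"
    by (rule reflpI) (simp add: uea_rel_def uea_ideal.zero)
  show "symp (uea_rel :: 'g free_algebra \<Rightarrow> _)"
  proof (rule sympI)
    fix p q :: "'g free_algebra"
    assume "uea_rel p q"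
    then show "uea_rel q p"
      using uea_ideal_uminus[of "p - q"] by (simp add: uea_rel_def)
  qed
  show "transp (uea_rel :: 'g free_algebra \<Rightarrow> _)"
  proof (rule transpI)
    fix p q r :: "'g free_algebra"
    assume "uea_rel p q" "uea_rel q r"
    then show "uea_rel p r"
      using uea_ideal.sum[of "p - q" "q - r"] by (simp add: uea_rel_def)
  qed
qed

text \<open>The ideal is proper: its elements have no constant term.\<close>

lemma plus_free_monoid_eq_0: "(0 = u + v) \<longleftrightarrow> u = 0 \<and> v = 0" for u v :: "'a free_monoid"
  by (cases u; cases v) (auto simp: zero_free_monoid_def)

lemma lookup_times_0:
  "Poly_Mapping.lookup (p * q) 0 = Poly_Mapping.lookup p 0 * Poly_Mapping.lookup q 0"
  for p q :: "'a free_algebra"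
proof -
  have "Sum_any (\<lambda>v. Poly_Mapping.lookup q v when 0 = u + v) =
      (Poly_Mapping.lookup q 0 when u = 0)" for u
    by (cases "u = 0") (simp_all add: plus_free_monoid_eq_0)
  then have "Poly_Mapping.lookup (p * q) 0 =
      Sum_any (\<lambda>u. Poly_Mapping.lookup p u * Poly_Mapping.lookup q 0 when u = 0)"
    by (simp add: lookup_mult mult_when)
  then show ?thesis by simp
qed

lemma lookup_free_gen_0: "Poly_Mapping.lookup (free_gen x) 0 = 0"
  by (simp add: free_gen_def lookup_single zero_free_monoid_def)

lemma uea_ideal_lookup_0: "p \<in> uea_ideal \<Longrightarrow> Poly_Mapping.lookup p 0 = 0"
  by (induction rule: uea_ideal.induct)
    (simp_all add: lookup_add lookup_minus lookup_times_0 lookup_free_gen_0 free_scale_def)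

lemma free_scale_commute: "p * Poly_Mapping.single 0 c = free_scale c p" for p :: "'a free_algebra"
proof (rule poly_mapping_eqI)
  fix k :: "'a free_monoid"
  have "Sum_any (\<lambda>v. (c when 0 = v) when k = u + v) = (c when k = u)" for u
  proof -
    have "Sum_any (\<lambda>v. (c when 0 = v) when k = u + v) = Sum_any (\<lambda>v::'a free_monoid. (c when k = u) when v = 0)"
      by (intro arg_cong[where f = Sum_any]) (auto simp: when_def fun_eq_iff)
    then show ?thesis by simp
  qed
  moreover have "Sum_any (\<lambda>v. Poly_Mapping.lookup p v when k = 0 + v) = Poly_Mapping.lookup p k"
    by simp
  moreover have "Sum_any (\<lambda>u. (c when 0 = u) * Sum_any (\<lambda>v. Poly_Mapping.lookup p v when k = u + v)) =
      Sum_any (\<lambda>u::'a free_monoid. c * Sum_any (\<lambda>v. Poly_Mapping.lookup p v when k = 0 + v) when u = 0)"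
    by (intro arg_cong[where f = Sum_any]) (auto simp: when_def fun_eq_iff)
  ultimately show "Poly_Mapping.lookup (p * Poly_Mapping.single 0 c) k =
      Poly_Mapping.lookup (free_scale c p) k"
    by (simp add: free_scale_def lookup_mult lookup_single mult_when mult.commute)
qed

instantiation uea :: (lie_algebra) real_algebra_1
begin

lift_definition zero_uea :: "'a uea" is 0 .

lift_definition one_uea :: "'a uea" is 1 .

lift_definition plus_uea :: "'a uea \<Rightarrow> 'a uea \<Rightarrow> 'a uea" is "(+)"
  unfolding uea_rel_def by (metis add_diff_add uea_ideal.sum)

lift_definition uminus_uea :: "'a uea \<Rightarrow> 'a uea" is uminus
  unfolding uea_rel_def by (metis minus_diff_minus uea_ideal_uminus)

lift_definition minus_uea :: "'a uea \<Rightarrow> 'a uea \<Rightarrow> 'a uea" is "(-)"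
proof -
  fix p q r s :: "'a free_algebra"
  assume "uea_rel p q" "uea_rel r s"
  then have "(p - q) + - (r - s) \<in> uea_ideal"
    unfolding uea_rel_def by (intro uea_ideal.sum uea_ideal_uminus)
  then show "uea_rel (p - r) (q - s)"
    unfolding uea_rel_def by (simp add: algebra_simps)
qed

lift_definition times_uea :: "'a uea \<Rightarrow> 'a uea \<Rightarrow> 'a uea" is "(*)"
proof -
  fix p q r s :: "'a free_algebra"
  assume "uea_rel p q" "uea_rel r s"
  then have "(p - q) * r + q * (r - s) \<in> uea_ideal"
    unfolding uea_rel_def by (intro uea_ideal.sum uea_ideal.left_mult uea_ideal.right_mult)
  then show "uea_rel (p * r) (q * s)"
    unfolding uea_rel_def by (simp add: algebra_simps)
qed

lift_definition scaleR_uea :: "real \<Rightarrow> 'a uea \<Rightarrow> 'a uea" is free_scale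
  unfolding uea_rel_def free_scale_def by (metis right_diff_distrib uea_ideal.left_mult)

instance
proof
  have eqI: "uea_rel p q" if "p = q" for p q :: "'a free_algebra"
    using that by (simp add: uea_rel_def uea_ideal.zero)
  fix a b c :: "'a uea" and r s :: real
  show "a + b + c = a + (b + c)" by transfer (rule eqI, simp add: algebra_simps)
  show "a + b = b + a" by transfer (rule eqI, simp add: algebra_simps)
  show "0 + a = a" by transfer (rule eqI, simp)
  show "- a + a = 0" by transfer (rule eqI, simp)
  show "a - b = a + - b" by transfer (rule eqI, simp)
  show "a * b * c = a * (b * c)" by transfer (rule eqI, simp add: mult.assoc)
  show "(a + b) * c = a * c + b * c" by transfer (rule eqI, simp add: algebra_simps)
  show "a * (b + c) = a * b + a * c" by transfer (rule eqI, simp add: algebra_simps)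
  show "1 * a = a" by transfer (rule eqI, simp)
  show "a * 1 = a" by transfer (rule eqI, simp)
  show "(0 :: 'a uea) \<noteq> 1"
    by transfer (auto simp: uea_rel_def lookup_minus dest: uea_ideal_lookup_0)
  show "r *\<^sub>R (a + b) = r *\<^sub>R a + r *\<^sub>R b"
    by transfer (rule eqI, simp add: free_scale_def algebra_simps)
  show "(r + s) *\<^sub>R a = r *\<^sub>R a + s *\<^sub>R a"
    by transfer (rule eqI, simp add: free_scale_def single_add algebra_simps)
  show "r *\<^sub>R s *\<^sub>R a = (r * s) *\<^sub>R a"
    by transfer (rule eqI, simp add: free_scale_def mult_single flip: mult.assoc)
  show "1 *\<^sub>R a = a" by transfer (rule eqI, simp add: free_scale_def)
  show "r *\<^sub>R a * b = r *\<^sub>R (a * b)"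
    by transfer (rule eqI, simp add: free_scale_def mult.assoc)
  show "a * r *\<^sub>R b = r *\<^sub>R (a * b)"
    by transfer (rule eqI, simp add: free_scale_def free_scale_commute[unfolded free_scale_def]
        flip: mult.assoc)
qed

end

lift_definition uea_of :: "'g::lie_algebra \<Rightarrow> 'g uea" is free_gen .

lemma uea_of_add: "uea_of (x + y) = uea_of x + uea_of y"
  by transfer (simp add: uea_rel_def uea_ideal.add)

lemma uea_of_scaleR: "uea_of (c *\<^sub>R x) = c *\<^sub>R uea_of x"
  by transfer (simp add: uea_rel_def uea_ideal.scale)

lemma uea_of_lie_bracket:
  "uea_of (lie_bracket x y) = uea_of x * uea_of y - uea_of y * uea_of x"
  by transfer (metis uea_rel_def uea_ideal.bracket uea_ideal_uminus minus_diff_eq)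


section \<open>Casimir operators\<close>

text \<open>
  The element of the enveloping algebra obtained by contracting a tensor of order \<open>n\<close> with
  the ordered monomials in the basis elements.
\<close>

definition uea_contraction ::
    "('n::finite \<Rightarrow> 'g::lie_algebra) \<Rightarrow> nat \<Rightarrow> 'n tensor \<Rightarrow> 'g uea" where
  "uea_contraction X n t =
     (\<Sum>is\<in>indices n. t is *\<^sub>R prod_list (map (\<lambda>i. uea_of (X i)) is))"

definition casimir_operator ::
    "('n::finite \<Rightarrow> 'g::lie_algebra) \<Rightarrow> nat \<Rightarrow> 'g uea \<Rightarrow> bool" where
  "casimir_operator X m u \<longleftrightarrow>
     (\<exists>h. sym_invariant_tensor X m h \<and> u = uea_contraction X m h)"

end

(*
  Since the cocycle Omega is antisymmetric, each product X_a X_b of neighbouring generators in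
  the contraction may be replaced by half the commutator, that is by C_ab^l X_l / 2. This gives
  2^-(m-1) h'^(l_1...l_m) X_(l_1)...X_(l_m) with
  h'_(l_1...l_(m-1) s) = Omega_(j_1...j_(2m-2) s) C_(j_1 j_2)^(l_1) ... C_(j_(2m-3) j_(2m-2))^(l_(m-1)).
  The tensor h' is invariant because Omega and C are. Symmetry under an exchange of l_i and s
  follows from the invariance of Omega, contracted with the structure constants of the other
  pairs: the terms acting on those pairs cancel by the Jacobi identity. Total antisymmetry of C
  comes from the cyclicity of the trace in the Killing form.
*)
theory Submission
  imports Defs
begin

section \<open>Sums over index lists and functions of multisets\<close>

lemma sum_rotate:
  "(\<Sum>i\<in>A. \<Sum>j\<in>B. \<Sum>k\<in>D. f i j k) = (\<Sum>j\<in>B. \<Sum>k\<in>D. \<Sum>i\<in>A. f i j k)"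
  for f :: "'a \<Rightarrow> 'b \<Rightarrow> 'c \<Rightarrow> 'd::comm_monoid_add"
  by (subst sum.swap, rule sum.cong[OF refl], rule sum.swap)

lemma indices_0: "indices 0 = {[]}"
  by (auto simp: indices_def)

lemma sum_indices_Suc:
  "(\<Sum>is\<in>indices (Suc n). f is) = (\<Sum>i\<in>UNIV. \<Sum>is\<in>indices n. f (i # is))"
  for f :: "'n::finite list \<Rightarrow> 'a::comm_monoid_add"
proof -
  have "(\<Sum>is\<in>indices (Suc n). f is) = (\<Sum>(i, is)\<in>UNIV \<times> indices n. f (i # is))"
    by (rule sum.reindex_bij_witness[of _ "\<lambda>(i, is). i # is" "\<lambda>is. (hd is, tl is)"])
      (auto simp: indices_def length_Suc_conv)
  then show ?thesis by (simp add: sum.cartesian_product)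
qed

lemma finite_indices: "finite (indices n :: 'n::finite list set)"
  using finite_lists_length_eq[of "UNIV :: 'n set" n] by (simp add: indices_def)

text \<open>Adjacent swaps bring the head of \<open>xs\<close> to the front of \<open>ys\<close>;
  the induction then continues on the tails, with the head absorbed into \<open>h\<close>.\<close>

lemma mset_cong_adjacent:
  assumes adj: "\<And>u a b v. h (u @ a # b # v) = h (u @ b # a # v)" and "mset xs = mset ys"
  shows "h xs = h ys"
  using assms
proof (induction xs arbitrary: h ys)
  case (Cons x xs)
  then obtain p q where ys: "ys = p @ x # q"
    by (metis list.set_intros(1) set_mset_mset split_list)
  have front: "h (p @ x # q) = h (x # p @ q)" for p q
  proof (induction p arbitrary: q rule: rev_induct)
    case (snoc y p)
    then show ?case using Cons.prems(1)[of p y x q] by simp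
  qed simp
  have "mset xs = mset (p @ q)" using Cons.prems(2) ys by simp
  moreover have "h (x # u @ a # b # v) = h (x # u @ b # a # v)" for u a b v
    using Cons.prems(1)[of "x # u" a b v] by simp
  ultimately have "h (x # xs) = h (x # p @ q)"
    using Cons.IH[of "\<lambda>xs. h (x # xs)" "p @ q"] by blast
  then show ?case by (simp add: ys front)
qed simp

section \<open>Antisymmetrisation over permutations\<close>

definition alternation :: "nat \<Rightarrow> 'n tensor \<Rightarrow> 'n tensor" where
  "alternation n T is = (\<Sum>\<pi> | \<pi> permutes {..<n}. of_int (sign \<pi>) * T (permute_list \<pi> is))"

text \<open>Each product of Kronecker deltas selects the single list
  \<open>permute_list (inv \<pi>) is\<close>, and passing to inverse permutations preserves
  signs.\<close>

lemma sum_gen_epsilon: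
  fixes T :: "'n::finite tensor"
  assumes "length is = n"
  shows "(\<Sum>js\<in>indices n. gen_epsilon n is js * T js) = alternation n T is"
proof -
  have delta: "(\<Sum>js\<in>indices n. (\<Prod>k<n. of_bool (is ! k = js ! \<pi> k)) * T js) =
      T (permute_list (inv \<pi>) is)" if \<pi>: "\<pi> permutes {..<n}" for \<pi>
  proof -
    have "(\<Prod>k<n. of_bool (is ! k = js ! \<pi> k)) = (of_bool (js = permute_list (inv \<pi>) is) :: real)"
      if js: "js \<in> indices n" for js
    proof -
      have "(\<forall>k<n. is ! k = js ! \<pi> k) \<longleftrightarrow> is = permute_list \<pi> js"
        using js assms \<pi> by (auto simp: indices_def list_eq_iff_nth_eq permute_list_nth)
      also have "\<dots> \<longleftrightarrow> js = permute_list (inv \<pi>) is"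
        using js assms \<pi> permutes_inv[OF \<pi>]
        by (auto simp: indices_def permutes_inv_o simp flip: permute_list_compose)
      finally show ?thesis by (auto simp flip: of_bool_conj)
    qed
    then have "(\<Sum>js\<in>indices n. (\<Prod>k<n. of_bool (is ! k = js ! \<pi> k)) * T js) =
        (\<Sum>js\<in>indices n. if js = permute_list (inv \<pi>) is then T js else 0)"
      by (intro sum.cong) auto
    also have "\<dots> = T (permute_list (inv \<pi>) is)"
      using assms by (simp add: sum.delta finite_indices) (simp add: indices_def)
    finally show ?thesis .
  qed
  have "(\<Sum>js\<in>indices n. gen_epsilon n is js * T js) =
      (\<Sum>\<pi> | \<pi> permutes {..<n}. of_int (sign \<pi>) *
        (\<Sum>js\<in>indices n. (\<Prod>k<n. of_bool (is ! k = js ! \<pi> k)) * T js))"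
    unfolding gen_epsilon_def sum_distrib_right sum_distrib_left mult.assoc by (rule sum.swap)
  also have "\<dots> = (\<Sum>\<pi> | \<pi> permutes {..<n}. of_int (sign (inv \<pi>)) * T (permute_list (inv \<pi>) is))"
    by (intro sum.cong refl) (auto simp: delta sign_inverse permutes_imp_permutation[of "{..<n}"])
  also have "\<dots> = alternation n T is"
    unfolding alternation_def by (rule sum_permutations_inverse[symmetric])
  finally show ?thesis .
qed

text \<open>Composition with the transposition \<open>?\<tau>\<close> of the two positions reindexes
  the sum over permutations and flips every sign.\<close>

lemma alternation_swap:
  assumes "length (u @ a # b # v) = n"
  shows "alternation n T (u @ a # b # v) = - alternation n T (u @ b # a # v)"
proof -
  let ?\<tau> = "transpose (length u) (Suc (length u))"
  have \<tau>: "?\<tau> permutes {..<n}"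
    using assms by (intro permutes_swap_id) auto
  have eq: "permute_list ?\<tau> (u @ a # b # v) = u @ b # a # v"
    using assms \<tau>
    by (intro nth_equalityI) (auto simp: permute_list_nth nth_append nth_Cons transpose_def split: nat.splits)
  have "alternation n T (u @ a # b # v) = (\<Sum>\<pi> | \<pi> permutes {..<n}.
      of_int (sign (?\<tau> \<circ> \<pi>)) * T (permute_list (?\<tau> \<circ> \<pi>) (u @ a # b # v)))"
    unfolding alternation_def by (rule setum_permutations_compose_left[OF \<tau>])
  also have "\<dots> = (\<Sum>\<pi> | \<pi> permutes {..<n}. - (of_int (sign \<pi>) * T (permute_list \<pi> (u @ b # a # v))))"
  proof (rule sum.cong[OF refl])
    fix \<pi> assume "\<pi> \<in> {\<pi>. \<pi> permutes {..<n}}"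
    then have \<pi>: "\<pi> permutes {..<n}" by simp
    have "sign (?\<tau> \<circ> \<pi>) = - sign \<pi>"
      using permutes_imp_permutation[OF _ \<pi>]
      by (simp add: sign_compose permutation_swap_id sign_swap_id)
    moreover have "permute_list (?\<tau> \<circ> \<pi>) (u @ a # b # v) = permute_list \<pi> (u @ b # a # v)"
      using permute_list_compose[of \<pi> "u @ a # b # v" ?\<tau>] \<pi> assms by (simp add: eq)
    ultimately show "of_int (sign (?\<tau> \<circ> \<pi>)) * T (permute_list (?\<tau> \<circ> \<pi>) (u @ a # b # v)) =
        - (of_int (sign \<pi>) * T (permute_list \<pi> (u @ b # a # v)))"
      by simp
  qed
  finally show ?thesis unfolding alternation_def sum_negf .
qed

section \<open>Structure constants and their action on tensors\<close>

text \<open>In coordinates, \<open>jacobi\<close> is the derivation rule [x, [a, b]] = [[x, a], b] +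
  [a, [x, b]]. Together with total antisymmetry it says that \<open>C\<close> is itself an invariant
  tensor.\<close>

locale skew_structure_constants =
  fixes C :: "'n::finite \<Rightarrow> 'n \<Rightarrow> 'n \<Rightarrow> real"
  assumes swap: "C i j k = - C j i k"
    and cyclic: "C i j k = C j k i"
    and jacobi: "(\<Sum>r\<in>UNIV. C a b r * C x r l) =
      (\<Sum>r\<in>UNIV. C x a r * C r b l) + (\<Sum>r\<in>UNIV. C x b r * C a r l)"
begin

lemma swap_right: "C i j k = - C i k j"
  by (metis swap cyclic)

text \<open>
  Up to sign, \<open>act x T\<close> is the Lie derivative of \<open>T\<close> along the basis vector with index \<open>x\<close>.
\<close>

definition act :: "'n \<Rightarrow> 'n tensor \<Rightarrow> 'n tensor" where
  "act x T is = (\<Sum>s<length is. \<Sum>r\<in>UNIV. C x (is ! s) r * T (is[s := r]))"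

lemma act_Nil [simp]: "act x T [] = 0"
  by (simp add: act_def)

lemma act_Cons [simp]:
  "act x T (i # is) = (\<Sum>r\<in>UNIV. C x i r * T (r # is)) + act x (\<lambda>js. T (i # js)) is"
  by (simp add: act_def sum.lessThan_Suc_shift del: sum.lessThan_Suc)

lemma act_sum: "act x (\<lambda>js. \<Sum>i\<in>A. c i * F i js) is = (\<Sum>i\<in>A. c i * act x (F i) is)"
proof -
  have "(\<Sum>r\<in>UNIV. C x y r * (\<Sum>i\<in>A. c i * F i (is[s := r]))) =
      (\<Sum>i\<in>A. c i * (\<Sum>r\<in>UNIV. C x y r * F i (is[s := r])))" for y s
    unfolding sum_distrib_left by (subst sum.swap) (simp add: mult.left_commute)
  then show ?thesis
    unfolding act_def sum_distrib_left by (simp add: sum_distrib_left sum.swap[of _ A])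
qed

section \<open>Contraction of pairs of slots with structure constants\<close>

text \<open>The index \<open>l\<close> created by the contraction is a parameter and not a slot, so
  that \<open>fold contr ls\<close> contracts successive pairs from the front.\<close>

definition contr :: "'n \<Rightarrow> 'n tensor \<Rightarrow> 'n tensor" where
  "contr l T js = (\<Sum>a\<in>UNIV. \<Sum>b\<in>UNIV. C a b l * T (a # b # js))"

lemma contr_pairs: "contr l T js = (\<Sum>p\<in>UNIV. C (fst p) (snd p) l * T (fst p # snd p # js))"
  unfolding contr_def UNIV_Times_UNIV[symmetric] sum.cartesian_product by (simp add: split_def)

lemma contr_sum: "contr l (\<lambda>js. \<Sum>i\<in>A. c i * F i js) = (\<lambda>js. \<Sum>i\<in>A. c i * contr l (F i) js)"
  unfolding contr_pairs sum_distrib_left by (subst sum.swap) (simp add: mult.left_commute)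

lemma contr_add: "contr l (\<lambda>js. F js + G js) = (\<lambda>js. contr l F js + contr l G js)"
  unfolding contr_pairs by (simp add: algebra_simps sum.distrib)

lemma fold_contr_0: "fold contr ls (\<lambda>_. 0) = (\<lambda>_. 0)"
  by (induction ls) (simp_all add: contr_def[abs_def])

lemma fold_contr_sum:
  "fold contr ls (\<lambda>js. \<Sum>i\<in>A. c i * F i js) tail = (\<Sum>i\<in>A. c i * fold contr ls (F i) tail)"
  by (induction ls arbitrary: F) (simp_all add: contr_sum)

lemma fold_contr_add:
  "fold contr ls (\<lambda>js. F js + G js) tail = fold contr ls F tail + fold contr ls G tail"
  by (induction ls arbitrary: F G) (simp_all add: contr_add)

text \<open>Contraction with the invariant tensor \<open>C\<close> is equivariant. The new index
  \<open>l\<close> is no slot of \<open>contr l T\<close>, so the action on it appears as a separate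
  term.\<close>

lemma contr_act:
  "contr l (act x T) js = (\<Sum>r\<in>UNIV. C x l r * contr r T js) + act x (contr l T) js"
proof -
  let ?F = "\<lambda>a b. T (a # b # js)"
  \<comment> \<open>The Jacobi identity, after antisymmetry in the last two indices of
    \<open>C x\<close> is applied to each term. It turns an action on the slots \<open>a\<close> and
    \<open>b\<close> into one on \<open>l\<close>.\<close>
  have key: "(\<Sum>r\<in>UNIV. C r b l * C x r a) + (\<Sum>r\<in>UNIV. C a r l * C x r b) =
      (\<Sum>r\<in>UNIV. C x l r * C a b r)" for a b
  proof -
    have "(\<Sum>r\<in>UNIV. C r b l * C x r a) = - (\<Sum>r\<in>UNIV. C x a r * C r b l)"
      unfolding sum_negf[symmetric] by (rule sum.cong) (auto simp: swap_right[of x _ a])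
    moreover have "(\<Sum>r\<in>UNIV. C a r l * C x r b) = - (\<Sum>r\<in>UNIV. C x b r * C a r l)"
      unfolding sum_negf[symmetric] by (rule sum.cong) (auto simp: swap_right[of x _ b])
    moreover have "(\<Sum>r\<in>UNIV. C x l r * C a b r) = - (\<Sum>r\<in>UNIV. C a b r * C x r l)"
      unfolding sum_negf[symmetric] by (rule sum.cong) (auto simp: swap_right[of x l])
    ultimately show ?thesis using jacobi[of a b x l] by simp
  qed
  have e1: "(\<Sum>a\<in>UNIV. \<Sum>b\<in>UNIV. C a b l * (\<Sum>r\<in>UNIV. C x a r * ?F r b)) =
      (\<Sum>a\<in>UNIV. \<Sum>b\<in>UNIV. (\<Sum>r\<in>UNIV. C r b l * C x r a) * ?F a b)"
  proof -
    have "(\<Sum>a\<in>UNIV. \<Sum>b\<in>UNIV. \<Sum>r\<in>UNIV. C a b l * (C x a r * ?F r b)) =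
        (\<Sum>b\<in>UNIV. \<Sum>r\<in>UNIV. \<Sum>a\<in>UNIV. C a b l * (C x a r * ?F r b))"
      by (subst sum.swap) (intro sum.cong[OF refl] sum.swap)
    also have "\<dots> = (\<Sum>r\<in>UNIV. \<Sum>b\<in>UNIV. \<Sum>a\<in>UNIV. C a b l * (C x a r * ?F r b))"
      by (rule sum.swap)
    finally show ?thesis by (simp add: sum_distrib_left sum_distrib_right mult.assoc)
  qed
  have e2: "(\<Sum>a\<in>UNIV. \<Sum>b\<in>UNIV. C a b l * (\<Sum>r\<in>UNIV. C x b r * ?F a r)) =
      (\<Sum>a\<in>UNIV. \<Sum>b\<in>UNIV. (\<Sum>r\<in>UNIV. C a r l * C x r b) * ?F a b)"
  proof (rule sum.cong[OF refl])
    fix a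
    have "(\<Sum>b\<in>UNIV. \<Sum>r\<in>UNIV. C a b l * (C x b r * ?F a r)) =
        (\<Sum>r\<in>UNIV. \<Sum>b\<in>UNIV. C a b l * (C x b r * ?F a r))"
      by (rule sum.swap)
    then show "(\<Sum>b\<in>UNIV. C a b l * (\<Sum>r\<in>UNIV. C x b r * ?F a r)) =
        (\<Sum>b\<in>UNIV. (\<Sum>r\<in>UNIV. C a r l * C x r b) * ?F a b)"
      by (simp add: sum_distrib_left sum_distrib_right mult.assoc)
  qed
  have e3: "act x (contr l T) js =
      (\<Sum>a\<in>UNIV. \<Sum>b\<in>UNIV. C a b l * act x (\<lambda>js. T (a # b # js)) js)"
    unfolding contr_pairs[abs_def] act_sum
    unfolding UNIV_Times_UNIV[symmetric] sum.cartesian_product by (simp add: split_def)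
  have e4: "(\<Sum>r\<in>UNIV. C x l r * contr r T js) =
      (\<Sum>a\<in>UNIV. \<Sum>b\<in>UNIV. (\<Sum>r\<in>UNIV. C x l r * C a b r) * ?F a b)"
    unfolding contr_def sum_distrib_left
    by (subst sum_rotate) (simp add: sum_distrib_right mult.assoc)
  have "contr l (act x T) js =
      (\<Sum>a\<in>UNIV. \<Sum>b\<in>UNIV. C a b l * (\<Sum>r\<in>UNIV. C x a r * ?F r b)) +
      (\<Sum>a\<in>UNIV. \<Sum>b\<in>UNIV. C a b l * (\<Sum>r\<in>UNIV. C x b r * ?F a r)) + act x (contr l T) js"
    unfolding e3 contr_def by (simp add: distrib_left sum.distrib)
  also have "\<dots> = (\<Sum>a\<in>UNIV. \<Sum>b\<in>UNIV. (\<Sum>r\<in>UNIV. C x l r * C a b r) * ?F a b) + act x (contr l T) js"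
    unfolding e1 e2 key[symmetric] by (simp only: distrib_right sum.distrib)
  finally show ?thesis unfolding e4 .
qed

text \<open>Iteration of \<open>contr_act\<close>: each contraction contributes the action on its
  own new index, and these terms add up to \<open>act\<close> on the list \<open>ls\<close>.\<close>

lemma fold_contr_act:
  "fold contr ls (act x T) tail =
     act x (\<lambda>ls. fold contr ls T tail) ls + act x (fold contr ls T) tail"
proof (induction ls arbitrary: T)
  case (Cons l ls)
  have "contr l (act x T) = (\<lambda>js. (\<Sum>r\<in>UNIV. C x l r * contr r T js) + act x (contr l T) js)"
    by (rule ext) (rule contr_act)
  then show ?case by (simp add: fold_contr_add fold_contr_sum Cons)
qed simp

section \<open>Expansion of tensor indices into pairs\<close>

text \<open>
  The tensor that \<open>cocycle_of\<close> antisymmetrises: every index of \<open>h\<close> but the last is replaced by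
  a pair.
\<close>

fun expand :: "'n tensor \<Rightarrow> 'n tensor" where
  "expand h (a # b # js) = (\<Sum>l\<in>UNIV. C a b l * expand (\<lambda>ls. h (l # ls)) js)"
| "expand h js = h js"

lemma expand_sum: "expand (\<lambda>js. \<Sum>i\<in>A. c i * F i js) js = (\<Sum>i\<in>A. c i * expand (F i) js)"
proof (induction "\<lambda>js. \<Sum>i\<in>A. c i * F i js" js arbitrary: F rule: expand.induct)
  case (1 a b js)
  have "expand (\<lambda>ls. \<Sum>i\<in>A. c i * F i (l # ls)) js = (\<Sum>i\<in>A. c i * expand (\<lambda>ls. F i (l # ls)) js)" for l
    by (rule 1) (rule UNIV_I, rule refl)
  then have "expand (\<lambda>js. \<Sum>i\<in>A. c i * F i js) (a # b # js) =
      (\<Sum>l\<in>UNIV. \<Sum>i\<in>A. C a b l * (c i * expand (\<lambda>ls. F i (l # ls)) js))"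
    by (simp add: sum_distrib_left)
  also have "\<dots> = (\<Sum>i\<in>A. c i * expand (F i) (a # b # js))"
    by (subst sum.swap) (simp add: sum_distrib_left mult.left_commute)
  finally show ?case .
qed simp_all

lemma expand_add: "expand (\<lambda>js. F js + G js) js = expand F js + expand G js"
proof (induction "\<lambda>js. F js + G js" js arbitrary: F G rule: expand.induct)
  case (1 a b js)
  have "expand (\<lambda>ls. F (l # ls) + G (l # ls)) js = expand (\<lambda>ls. F (l # ls)) js + expand (\<lambda>ls. G (l # ls)) js" for l
    by (rule 1) (rule UNIV_I, rule refl)
  then show ?case
    by (simp add: algebra_simps sum.distrib)
qed simp_all

text \<open>By the Jacobi identity, acting on the two slots of a pair amounts to acting on the index
  of \<open>h\<close> that the pair replaces. Hence invariance passes from \<open>h\<close> to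
  \<open>expand h\<close>.\<close>

lemma act_expand: "act x (expand h) js = expand (act x h) js"
proof (induction h js rule: expand.induct)
  case (1 h a b js)
  let ?E = "\<lambda>l. expand (\<lambda>ls. h (l # ls)) js"
  have sw: "(\<Sum>r\<in>UNIV. c r * (\<Sum>l\<in>UNIV. d r l * ?E l)) =
      (\<Sum>l\<in>UNIV. (\<Sum>r\<in>UNIV. c r * d r l) * ?E l)" for c :: "'n \<Rightarrow> real" and d
    unfolding sum_distrib_left by (subst sum.swap) (simp add: sum_distrib_right mult.assoc)
  show ?case
    by (simp add: expand_add expand_sum 1 act_sum distrib_left sum.distrib sw jacobi[of a b x] distrib_right)
qed simp_all

section \<open>Alternating tensors and their contractions\<close>

text \<open>Imposed on lists of every length, so that freezing the leading index and contracting a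
  pair stay within the notion.\<close>

definition alternating :: "'n tensor \<Rightarrow> bool" where
  "alternating T \<longleftrightarrow> (\<forall>u a b v. T (u @ a # b # v) = - T (u @ b # a # v))"

lemma alternatingD: "alternating T \<Longrightarrow> T (u @ a # b # v) = - T (u @ b # a # v)"
  unfolding alternating_def by blast

lemma alternating_Cons: "alternating T \<Longrightarrow> alternating (\<lambda>js. T (a # js))"
  unfolding alternating_def by (metis append_Cons)

lemma alternating_rot: "alternating T \<Longrightarrow> T (a # b # c # v) = T (b # c # a # v)"
  using alternatingD[of T "[]" a b "c # v"] alternatingD[of T "[b]" a c v] by simp

lemma alternating_contr:
  assumes "alternating T"
  shows "alternating (contr l T)"
proof -
  have "T (p # q # u @ a # b # v) = - T (p # q # u @ b # a # v)" for p q u a b v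
    using alternatingD[OF assms, of "p # q # u" a b v] by simp
  then show ?thesis
    unfolding alternating_def contr_def sum_negf[symmetric]
    by (intro allI sum.cong refl) (metis mult_minus_right)
qed

text \<open>Moving \<open>j\<close> past the contracted pair is a 3-cycle, hence even, and no sign
  appears.\<close>

lemma contr_Cons:
  assumes "alternating T"
  shows "contr l (\<lambda>js. T (j # js)) = (\<lambda>js. contr l T (j # js))"
  unfolding contr_def by (simp add: alternating_rot[OF assms, of j])

lemma fold_contr_Cons:
  assumes "alternating T"
  shows "fold contr ls T (j # tail) = fold contr ls (\<lambda>js. T (j # js)) tail"
  using assms
proof (induction ls arbitrary: T)
  case (Cons l ls)
  then show ?case
    by (simp add: contr_Cons[OF Cons.prems] alternating_contr)
qed simp

lemma alternating_fold_contr: "alternating T \<Longrightarrow> alternating (fold contr ls T)"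
  by (induction ls arbitrary: T) (simp_all add: alternating_contr)

section \<open>Symmetry and invariance of the contracted tensor\<close>

text \<open>The alternating slots \<open>j\<close>, \<open>a\<close>, \<open>b\<close> may be
  rotated freely, so the coefficient can be replaced by its cyclic mean, which vanishes by the
  Jacobi identity.\<close>

lemma sum_contr_0:
  assumes "alternating T"
  shows "(\<Sum>j\<in>UNIV. \<Sum>r\<in>UNIV. C j l r * contr r T (j # js)) = 0"
proof -
  define F where "F j a b = T (a # b # j # js)" for j a b
  define K where "K j a b = (\<Sum>r\<in>UNIV. C j l r * C a b r)" for j a b
  have rotF: "F j a b = F a b j" for j a b
    unfolding F_def using alternating_rot[OF assms] by metis
  \<comment> \<open>Total antisymmetry brings all three terms to the form required by
    \<open>jacobi\<close>.\<close>
  have K0: "K j a b + K a b j + K b j a = 0" for j a b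
  proof -
    have "K j a b = (\<Sum>r\<in>UNIV. C a b r * C r j l)" for j a b
      unfolding K_def by (rule sum.cong) (auto simp: cyclic[of _ j l])
    moreover have "(\<Sum>r\<in>UNIV. C a b r * C j r l) = - (\<Sum>r\<in>UNIV. C a b r * C r j l)"
      unfolding sum_negf[symmetric] by (rule sum.cong) (auto simp: swap[of j])
    moreover have "(\<Sum>r\<in>UNIV. C j b r * C a r l) = (\<Sum>r\<in>UNIV. C b j r * C r a l)"
      by (rule sum.cong) (auto simp: swap[of j b] swap[of a])
    ultimately show ?thesis using jacobi[of a b j l] by simp
  qed
  let ?S = "\<lambda>G. (\<Sum>j\<in>UNIV. \<Sum>a\<in>UNIV. \<Sum>b\<in>UNIV. G j a b :: real)"
  \<comment> \<open>Cyclic renaming of the summation indices leaves \<open>F\<close> unchanged, so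
    the three sums over rotated \<open>K\<close> agree. Their total is zero by \<open>K0\<close>,
    hence so is each of them.\<close>
  have 1: "?S (\<lambda>j a b. K j a b * F j a b) = ?S (\<lambda>j a b. K b j a * F j a b)"
    by (subst sum_rotate, intro sum.cong refl) (metis rotF)
  have 2: "?S (\<lambda>j a b. K j a b * F j a b) = ?S (\<lambda>j a b. K a b j * F j a b)"
    unfolding 1 by (subst sum_rotate, intro sum.cong refl) (metis rotF)
  have "?S (\<lambda>j a b. K j a b * F j a b) + ?S (\<lambda>j a b. K a b j * F j a b) + ?S (\<lambda>j a b. K b j a * F j a b) = 0"
    by (simp only: sum.distrib[symmetric] distrib_right[symmetric] K0) simp
  then have "?S (\<lambda>j a b. K j a b * F j a b) = 0"
    using 1 2 by simp
  moreover have "(\<Sum>r\<in>UNIV. C j l r * contr r T (j # js)) = (\<Sum>a\<in>UNIV. \<Sum>b\<in>UNIV. K j a b * F j a b)" for j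
    unfolding contr_def sum_distrib_left K_def F_def
    by (subst sum_rotate) (simp add: sum_distrib_right mult.assoc)
  ultimately show ?thesis by simp
qed

text \<open>
  Contracting the direction of the derivative with an antisymmetric slot of \<open>T\<close> kills the
  terms that act on the contracted pairs, by the Jacobi identity.
\<close>

lemma sum_act_fold_contr_0:
  assumes "alternating T"
  shows "(\<Sum>j\<in>UNIV. act j (\<lambda>ls. fold contr ls T (j # tail)) ls) = 0"
  using assms
proof (induction ls arbitrary: T)
  case (Cons l ls)
  \<comment> \<open>The action on the index \<open>l\<close> alone: \<open>j\<close> and the sums
    are pulled inside the remaining contractions, where \<open>sum_contr_0\<close> applies.\<close>
  have "(\<Sum>j\<in>UNIV. \<Sum>r\<in>UNIV. C j l r * fold contr ls (contr r T) (j # tail)) = 0"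
  proof -
    have *: "fold contr ls (contr r T) (j # tail) = fold contr ls (\<lambda>js. contr r T (j # js)) tail" for r j
      using Cons.prems by (simp add: fold_contr_Cons alternating_contr)
    have "(\<Sum>j\<in>UNIV. \<Sum>r\<in>UNIV. C j l r * fold contr ls (contr r T) (j # tail)) =
      fold contr ls (\<lambda>js. \<Sum>p\<in>UNIV. C (fst p) l (snd p) * contr (snd p) T (fst p # js)) tail"
      unfolding fold_contr_sum *
      by (simp add: sum.cartesian_product split_def)
    also have "(\<lambda>js. \<Sum>p\<in>UNIV. C (fst p) l (snd p) * contr (snd p) T (fst p # js)) =
       (\<lambda>_. 0)"
      using sum_contr_0[OF Cons.prems, of l]
      by (simp add: sum.cartesian_product split_def)
    finally show ?thesis by (simp add: fold_contr_0)
  qed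
  then show ?case
    using Cons.IH[OF alternating_contr[OF Cons.prems, of l]]
    by (simp add: sum.distrib)
qed simp

text \<open>
  Invariance of \<open>fold contr ls T\<close>, evaluated at the indices \<open>[j, a, b]\<close> in the direction \<open>j\<close>
  and summed over \<open>j\<close>, leaves only the difference of the two sides.
\<close>

lemma contr_swap_last:
  assumes alt: "alternating T" and inv: "\<And>x. act x T = (\<lambda>_. 0)"
  shows "contr a (fold contr ls T) [b] = contr b (fold contr ls T) [a]"
proof -
  let ?G = "fold contr ls T"
  have G: "alternating ?G" by (rule alternating_fold_contr[OF alt])
  \<comment> \<open>The direction \<open>j\<close> also occupies the first slot; this disposes of
    the action on that slot.\<close>
  have C0: "C j j r = 0" for j r
    using swap[of j j r] by simp
  have "(\<Sum>j\<in>UNIV. fold contr ls (act j T) [j, a, b]) = 0"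
    by (simp add: inv fold_contr_0)
  then have "(\<Sum>j\<in>UNIV. act j ?G [j, a, b]) = 0"
    by (simp add: fold_contr_act sum.distrib sum_act_fold_contr_0[OF alt] del: act_Cons)
  then have "(\<Sum>j\<in>UNIV. \<Sum>r\<in>UNIV. C j a r * ?G [j, r, b]) + (\<Sum>j\<in>UNIV. \<Sum>r\<in>UNIV. C j b r * ?G [j, a, r]) = 0"
    by (simp add: C0 sum.distrib)
  moreover have "?G [j, a, r] = - ?G [j, r, a]" for j r
    using alternatingD[OF G, of "[j]" a r "[]"] by simp
  ultimately show ?thesis
    unfolding contr_def
    by (simp add: sum_negf swap_right[of _ a] swap_right[of _ b])
qed

text \<open>Exchanging two pairs of slots is an even permutation, so an alternating tensor does not
  notice it.\<close>

lemma contr_commute: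
  assumes "alternating T"
  shows "contr a (contr b T) = contr b (contr a T)"
proof
  fix js
  have rot: "T (p # q # r # s # js) = T (r # s # p # q # js)" for p q r s
    using alternating_rot[OF assms, of p q r "s # js"] alternating_rot[OF assms, of q r p "s # js"]
      alternating_rot[OF alternating_Cons[OF assms, of r], of p q s js]
      alternating_rot[OF alternating_Cons[OF assms, of r], of q s p js] by simp
  have "contr a (contr b T) js =
      (\<Sum>p\<in>UNIV. \<Sum>q\<in>UNIV. C (fst p) (snd p) a * (C (fst q) (snd q) b * T (fst q # snd q # fst p # snd p # js)))"
    unfolding contr_pairs sum_distrib_left ..
  also have "\<dots> = (\<Sum>q\<in>UNIV. \<Sum>p\<in>UNIV. C (fst q) (snd q) b * (C (fst p) (snd p) a * T (fst p # snd p # fst q # snd q # js)))"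
    by (subst sum.swap, intro sum.cong refl) (metis rot mult.left_commute)
  also have "\<dots> = contr b (contr a T) js"
    unfolding contr_pairs sum_distrib_left ..
  finally show "contr a (contr b T) js = contr b (contr a T) js" .
qed

lemma fold_contr_contr:
  assumes "alternating T"
  shows "fold contr ls (contr a T) = contr a (fold contr ls T)"
  using assms
proof (induction ls arbitrary: T)
  case (Cons l ls)
  then show ?case
    using Cons.IH[OF alternating_contr[OF Cons.prems, of l]] contr_commute[OF Cons.prems, of l a]
    by simp
qed simp

text \<open>
  \<open>lower T (ls @ [s])\<close> contracts the first \<open>2 * length ls\<close> slots of \<open>T\<close> pairwise with structure
  constants; it is meaningful only for a nonempty list of indices.
\<close>

definition lower :: "'n tensor \<Rightarrow> 'n tensor" where
  "lower T is = fold contr (butlast is) T [last is]"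

lemma lower_Cons: "is \<noteq> [] \<Longrightarrow> lower T (l # is) = lower (contr l T) is"
  by (simp add: lower_def)

lemma act_append:
  "act x T (u @ v) = act x (\<lambda>u. T (u @ v)) u + act x (\<lambda>v. T (u @ v)) v"
  by (induction u arbitrary: T) simp_all

lemma act_lower:
  assumes inv: "\<And>x. act x T = (\<lambda>_. 0)" and "is \<noteq> []"
  shows "act x (lower T) is = 0"
proof -
  obtain ls s where "is": "is = ls @ [s]"
    using \<open>is \<noteq> []\<close> by (cases "is" rule: rev_cases) auto
  have "act x (lower T) is = fold contr ls (act x T) [s]"
    unfolding "is" act_append fold_contr_act by (simp add: lower_def)
  then show ?thesis by (simp add: inv fold_contr_0)
qed

text \<open>Transpositions with the last index generate all permutations. Since contractions
  commute, any other index can be contracted last, and \<open>contr_swap_last\<close> then exchanges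
  it with the last one.\<close>

lemma lower_mset_cong:
  assumes alt: "alternating T" and inv: "\<And>x. act x T = (\<lambda>_. 0)" and "mset xs = mset ys"
  shows "lower T xs = lower T ys"
proof -
  have star: "lower T (u @ a # v @ [b]) = lower T (u @ b # v @ [a])" for u a v b
  proof -
    have "lower T (u @ a # v @ [b]) = contr a (fold contr (u @ v) T) [b]" for a b
      by (simp add: lower_def butlast_append fold_contr_contr alternating_fold_contr[OF alt])
    then show ?thesis using contr_swap_last[OF alt inv] by metis
  qed
  have "lower T (u @ a # b # v) = lower T (u @ b # a # v)" for u a b v
  proof (cases v rule: rev_cases)
    case Nil
    then show ?thesis using star[of u a "[]" b] by simp
  next
    case (snoc w c)
    \<comment> \<open>With \<open>c\<close> the last index, the swap of \<open>a\<close> and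
      \<open>b\<close> is a product of three exchanges with the last position.\<close>
    then show ?thesis
      using star[of u a "b # w" c] star[of "u @ [c]" b w a] star[of u c "a # w" b] by simp
  qed
  then show ?thesis using \<open>mset xs = mset ys\<close> by (rule mset_cong_adjacent)
qed

section \<open>Slot permutations and the closed form of \<open>expand\<close>\<close>

lemma act_cong:
  assumes "\<And>js. length js = length is \<Longrightarrow> T js = T' js"
  shows "act x T is = act x T' is"
  using assms by (simp add: act_def)

text \<open>The action treats all slots alike: reindexing its sum by \<pi> matches slot
  \<open>\<pi> s\<close> of \<open>is\<close> with slot \<open>s\<close> of the permuted
  list.\<close>

lemma act_permute_list:
  assumes "\<pi> permutes {..<length is}"
  shows "act x (\<lambda>is. T (permute_list \<pi> is)) is = act x T (permute_list \<pi> is)"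
proof -
  have upd: "permute_list \<pi> (is[\<pi> s := r]) = (permute_list \<pi> is)[s := r]" if "s < length is" for s r
  proof (rule nth_equalityI)
    fix k assume "k < length (permute_list \<pi> (is[\<pi> s := r]))"
    then have k: "k < length is" by simp
    have "\<pi> k < length is" using permutes_in_image[OF assms, of k] k by simp
    then show "permute_list \<pi> (is[\<pi> s := r]) ! k = (permute_list \<pi> is)[s := r] ! k"
      using k that assms permutes_inj[OF assms]
      by (simp add: permute_list_nth nth_list_update inj_eq)
  qed simp
  let ?g = "\<lambda>s. \<Sum>r\<in>UNIV. C x (is ! s) r * T (permute_list \<pi> (is[s := r]))"
  have "act x (\<lambda>is. T (permute_list \<pi> is)) is = sum (?g \<circ> \<pi>) {..<length is}"
    unfolding act_def by (rule sum.permute[OF assms])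
  also have "\<dots> = act x T (permute_list \<pi> is)"
    unfolding act_def using assms by (simp add: upd permute_list_nth)
  finally show ?thesis .
qed

text \<open>Ties the recursion to the formula in \<open>cocycle_of\<close>, with \<open>k\<close>
  standing for \<open>m - 1\<close>: each step peels a pair off \<open>js\<close> and the matching
  index off \<open>ls\<close>.\<close>

lemma expand_eq_sum:
  assumes "length js = 2 * k + 1"
  shows "expand h js =
    (\<Sum>ls\<in>indices k. (\<Prod>s<k. C (js ! (2 * s)) (js ! (2 * s + 1)) (ls ! s)) * h (ls @ [js ! (2 * k)]))"
  using assms
proof (induction k arbitrary: h js)
  case 0
  then obtain j where "js = [j]" by (auto simp: length_Suc_conv)
  then show ?case by (simp add: indices_0)
next
  case (Suc k)
  then obtain a b js' where js: "js = a # b # js'" and len: "length js' = 2 * k + 1"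
    by (auto simp: length_Suc_conv)
  show ?case
    by (simp add: js Suc.IH[OF len] sum_indices_Suc prod.lessThan_Suc_shift sum_distrib_left mult.assoc
        del: prod.lessThan_Suc)
qed

end

section \<open>Structure constants in a Killing-normalised basis\<close>

lemma linear_lie_bracket: "linear (lie_bracket x)"
  by (rule linearI) (simp_all add: lie_bracket_add_right lie_bracket_scaleR_right)

lemma lie_bracket_minus: "lie_bracket x y = - lie_bracket y x"
proof -
  have "lie_bracket (x + y) (x + y) = lie_bracket x y + lie_bracket y x"
    unfolding lie_bracket_add_left lie_bracket_add_right by (simp add: lie_bracket_self)
  then show ?thesis by (simp add: lie_bracket_self eq_neg_iff_add_eq_0)
qed

lemma linear_uea_of: "linear uea_of"
  by (rule linearI) (simp_all add: uea_of_add uea_of_scaleR)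

locale killing_normalised_basis =
  fixes X :: "'n::finite \<Rightarrow> 'g::lie_algebra"
  assumes basis: "lie_basis X" and normalised: "killing_normalised X"
begin

abbreviation C where "C \<equiv> structure_const X"

definition coord :: "'g \<Rightarrow> 'n \<Rightarrow> real" where
  "coord v k = representation (range X) v (X k)"

lemma independent_basis: "independent (range X)" and span_basis: "span (range X) = UNIV"
  and inj_basis: "inj X"
  using basis by (auto simp: lie_basis_def)

lemma coord_add: "coord (u + v) k = coord u k + coord v k"
  by (simp add: coord_def representation_add independent_basis span_basis)

lemma coord_uminus: "coord (- v) k = - coord v k"
  by (simp add: coord_def representation_neg independent_basis span_basis)

lemma coord_0: "coord 0 k = 0"
  by (simp add: coord_def representation_zero)

lemma coord_sum: "coord (\<Sum>i\<in>A. c i *\<^sub>R v i) k = (\<Sum>i\<in>A. c i * coord (v i) k)"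
  by (simp add: coord_def representation_sum representation_scale independent_basis span_basis)

lemma coord_bracket: "coord (lie_bracket (X i) (X j)) k = C i j k"
  by (simp add: coord_def structure_const_def)

lemma coord_bracket_bracket:
  "coord (lie_bracket (X i) (lie_bracket (X j) (X k))) l = (\<Sum>r\<in>UNIV. C j k r * C i r l)"
  unfolding lie_bracket_structure_const[OF basis, of j k]
  by (simp add: linear_sum[OF linear_lie_bracket] linear_scale[OF linear_lie_bracket]
      coord_sum coord_bracket)

lemma structure_const_swap: "C i j k = - C j i k"
  unfolding coord_bracket[symmetric] coord_uminus[symmetric]
  by (subst lie_bracket_minus) (rule refl)

lemma structure_const_jacobi:
  "(\<Sum>r\<in>UNIV. C a b r * C x r l) =
     (\<Sum>r\<in>UNIV. C x a r * C r b l) + (\<Sum>r\<in>UNIV. C x b r * C a r l)"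
proof -
  have "(\<Sum>r\<in>UNIV. C a b r * C x r l) + (\<Sum>r\<in>UNIV. C b x r * C a r l) + (\<Sum>r\<in>UNIV. C x a r * C b r l) = 0"
    using arg_cong[OF lie_jacobi[of "X x" "X a" "X b"], of "\<lambda>v. coord v l"]
    by (simp add: coord_add coord_bracket_bracket coord_0)
  moreover have "(\<Sum>r\<in>UNIV. C b x r * C a r l) = - (\<Sum>r\<in>UNIV. C x b r * C a r l)"
    unfolding sum_negf[symmetric] by (intro sum.cong refl) (metis structure_const_swap mult_minus_left)
  moreover have "(\<Sum>r\<in>UNIV. C x a r * C b r l) = - (\<Sum>r\<in>UNIV. C x a r * C r b l)"
    unfolding sum_negf[symmetric] by (intro sum.cong refl) (metis structure_const_swap mult_minus_right)
  ultimately show ?thesis by linarith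
qed

text \<open>By \<open>lin_trace_eq\<close> the trace may be computed in the basis \<open>X\<close>
  itself.\<close>

lemma killing_form_structure_const:
  "killing_form (X i) (X j) = (\<Sum>a\<in>UNIV. \<Sum>b\<in>UNIV. C j a b * C i b a)"
proof -
  have "linear (\<lambda>z. lie_bracket (X i) (lie_bracket (X j) z))"
    using linear_compose[OF linear_lie_bracket linear_lie_bracket] by (simp add: o_def)
  then have "killing_form (X i) (X j) =
      (\<Sum>v\<in>range X. representation (range X) (lie_bracket (X i) (lie_bracket (X j) v)) v)"
    unfolding killing_form_def
    by (rule lin_trace_eq) (simp_all add: independent_basis span_basis)
  then show ?thesis
    by (simp add: sum.reindex inj_basis coord_bracket_bracket flip: coord_def)
qed

text \<open>Normalisation identifies \<open>- c * C i j k\<close> with the Killing form of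
  [X_i, X_j] and X_k. This is tr(ad X_i ad X_j ad X_k) - tr(ad X_j ad X_i ad X_k), and both traces
  are cyclic.\<close>

lemma structure_const_cyclic: "C i j k = C j k i"
proof -
  obtain c where "c > 0" and c: "\<And>i j. killing_form (X i) (X j) = (if i = j then - c else 0)"
    using normalised unfolding killing_normalised_def by blast
  \<comment> \<open>\<open>U i j k\<close> is the trace of ad X_k ad X_j ad X_i.\<close>
  define U where "U i j k = (\<Sum>a\<in>UNIV. \<Sum>b\<in>UNIV. \<Sum>r\<in>UNIV. C i a b * (C j b r * C k r a))" for i j k
  have U_rot: "U i j k = U j k i" for i j k
    unfolding U_def by (subst sum_rotate) (simp add: mult.commute mult.left_commute)
  have "- c * C i j k = U k j i - U k i j" for i j k
  proof -
    have "- c * C i j k = (\<Sum>l\<in>UNIV. C i j l * killing_form (X l) (X k))"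
      by (simp add: c if_distrib[of "\<lambda>x. _ * x"] sum.delta cong: if_cong)
    also have "\<dots> = (\<Sum>a\<in>UNIV. \<Sum>b\<in>UNIV. C k a b * (\<Sum>l\<in>UNIV. C i j l * C l b a))"
      unfolding killing_form_structure_const sum_distrib_left
      by (subst sum_rotate) (simp add: mult.left_commute)
    \<comment> \<open>The Jacobi identity writes ad [X_i, X_j] as the commutator of ad X_i and ad
      X_j.\<close>
    also have "\<dots> = (\<Sum>a\<in>UNIV. \<Sum>b\<in>UNIV. C k a b *
        ((\<Sum>r\<in>UNIV. C j b r * C i r a) - (\<Sum>r\<in>UNIV. C i b r * C j r a)))"
      using structure_const_jacobi[of j _ i] by simp
    also have "\<dots> = U k j i - U k i j"
      by (simp add: U_def right_diff_distrib sum_subtractf sum_distrib_left)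
    finally show ?thesis .
  qed
  then have "- c * C i j k = - c * C j k i"
    using U_rot[of k j i] U_rot[of j i k] U_rot[of k i j] by simp
  then show ?thesis using \<open>c > 0\<close> by simp
qed

sublocale skew_structure_constants "structure_const X"
  by unfold_locales (fact structure_const_swap structure_const_cyclic structure_const_jacobi)+

section \<open>Invariance of the cocycle\<close>

lemma invariant_tensor_iff: "invariant_tensor X m h \<longleftrightarrow> (\<forall>x. \<forall>is\<in>indices m. act x h is = 0)"
  by (auto simp: invariant_tensor_def act_def indices_def)

lemma cocycle_of_eq:
  assumes "length is = 2 * k + 1"
  shows "cocycle_of X (Suc k) h is = alternation (2 * k + 1) (expand h) is / fact (2 * k + 1)"
proof -
  have "alternation (2 * k + 1) (expand h) is =
      (\<Sum>js\<in>indices (2 * k + 1). gen_epsilon (2 * k + 1) is js * expand h js)"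
    using sum_gen_epsilon[OF assms] by simp
  also have "\<dots> = (\<Sum>js\<in>indices (2 * k + 1). gen_epsilon (2 * k + 1) is js *
      (\<Sum>ls\<in>indices k. (\<Prod>s<k. C (js ! (2 * s)) (js ! (2 * s + 1)) (ls ! s)) * h (ls @ [js ! (2 * k)])))"
    by (intro sum.cong refl) (subst expand_eq_sum[of _ k], auto simp: indices_def)
  finally show ?thesis
    by (simp add: cocycle_of_def)
qed

text \<open>Invariance passes from \<open>h\<close> to \<open>expand h\<close> by
  \<open>act_expand\<close>, and from there to every term of the antisymmetrisation because the
  action commutes with permutations of slots.\<close>

lemma act_cocycle_of:
  assumes "invariant_tensor X (Suc k) h" and len: "length is = 2 * k + 1"
  shows "act x (cocycle_of X (Suc k) h) is = 0"
proof -
  have expand_0: "act x (expand h) js = 0" if "length js = 2 * k + 1" for js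
    unfolding act_expand expand_eq_sum[OF that]
    using assms(1) by (intro sum.neutral) (auto simp: invariant_tensor_iff indices_def)
  let ?P = "{\<pi>. \<pi> permutes {..<2 * k + 1}}"
  have "act x (cocycle_of X (Suc k) h) is =
      act x (\<lambda>is. \<Sum>\<pi>\<in>?P. (of_int (sign \<pi>) / fact (2 * k + 1)) * expand h (permute_list \<pi> is)) is"
    by (rule act_cong) (simp add: cocycle_of_eq len alternation_def sum_divide_distrib del: fact_Suc)
  also have "\<dots> = (\<Sum>\<pi>\<in>?P. (of_int (sign \<pi>) / fact (2 * k + 1)) * act x (expand h) (permute_list \<pi> is))"
    unfolding act_sum using act_permute_list[of _ "is" x] len by (intro sum.cong refl) simp
  also have "\<dots> = 0"
    using len by (simp add: expand_0)
  finally show ?thesis .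
qed

section \<open>Contractions in the enveloping algebra\<close>

lemma uea_contraction_cong:
  "(\<And>is. length is = n \<Longrightarrow> T is = T' is) \<Longrightarrow> uea_contraction X n T = uea_contraction X n T'"
  by (simp add: uea_contraction_def indices_def)

lemma uea_contraction_Suc:
  "uea_contraction X (Suc n) T = (\<Sum>i\<in>UNIV. uea_of (X i) * uea_contraction X n (\<lambda>is. T (i # is)))"
  by (simp add: uea_contraction_def sum_indices_Suc sum_distrib_left)

lemma uea_contraction_scale:
  "uea_contraction X n (\<lambda>is. c * T is) = c *\<^sub>R uea_contraction X n T"
  by (simp add: uea_contraction_def scaleR_sum_right)

text \<open>Against antisymmetric coefficients only half the commutator of the two generators
  survives, and in the enveloping algebra the commutator is the bracket.\<close>

lemma sum_alternating_pair:
  assumes "alternating T"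
  shows "(\<Sum>a\<in>UNIV. \<Sum>b\<in>UNIV. T (a # b # js) *\<^sub>R (uea_of (X a) * uea_of (X b))) =
    (1 / 2) *\<^sub>R (\<Sum>l\<in>UNIV. contr l T js *\<^sub>R uea_of (X l))"
proof -
  let ?x = "\<lambda>i. uea_of (X i)"
  let ?S = "\<Sum>a\<in>UNIV. \<Sum>b\<in>UNIV. T (a # b # js) *\<^sub>R (?x a * ?x b)"
  have "T (a # b # js) = - T (b # a # js)" for a b
    using alternatingD[OF assms, of "[]" a b js] by simp
  then have "?S = (\<Sum>a\<in>UNIV. \<Sum>b\<in>UNIV. - (T (b # a # js) *\<^sub>R (?x a * ?x b)))"
    by (intro sum.cong refl) (metis scaleR_minus_left)
  also have "\<dots> = - (\<Sum>a\<in>UNIV. \<Sum>b\<in>UNIV. T (a # b # js) *\<^sub>R (?x b * ?x a))"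
    by (subst sum.swap) (simp add: sum_negf)
  finally have "?S + ?S = (\<Sum>a\<in>UNIV. \<Sum>b\<in>UNIV. T (a # b # js) *\<^sub>R (?x a * ?x b - ?x b * ?x a))"
    by (simp add: scaleR_diff_right sum_subtractf)
  also have "\<dots> = (\<Sum>a\<in>UNIV. \<Sum>b\<in>UNIV. \<Sum>l\<in>UNIV. (T (a # b # js) * C a b l) *\<^sub>R ?x l)"
    by (simp add: linear_sum[OF linear_uea_of] uea_of_scaleR scaleR_sum_right
        lie_bracket_structure_const[OF basis] flip: uea_of_lie_bracket)
  also have "\<dots> = (\<Sum>l\<in>UNIV. \<Sum>a\<in>UNIV. \<Sum>b\<in>UNIV. (T (a # b # js) * C a b l) *\<^sub>R ?x l)"
    by (rule sum_rotate[symmetric])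
  also have "\<dots> = (\<Sum>l\<in>UNIV. contr l T js *\<^sub>R ?x l)"
    by (simp add: contr_def scaleR_sum_left mult.commute)
  finally have "?S + ?S = (\<Sum>l\<in>UNIV. contr l T js *\<^sub>R ?x l)" .
  moreover have "?S = (1 / 2) *\<^sub>R (?S + ?S)"
    by (simp add: scaleR_half_double)
  ultimately show ?thesis by simp
qed

text \<open>Each step trades the two leading generators for one, at the cost of a factor 1/2, and
  leaves the alternating tensor \<open>contr l T\<close> for the rest. After \<open>k\<close> steps
  only the last generator is unpaired.\<close>

lemma uea_contraction_lower:
  assumes "alternating T"
  shows "uea_contraction X (2 * k + 1) T = (1 / 2) ^ k *\<^sub>R uea_contraction X (Suc k) (lower T)"
  using assms
proof (induction k arbitrary: T)
  case 0
  have "uea_contraction X 1 T = uea_contraction X 1 (lower T)"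
    by (rule uea_contraction_cong) (auto simp: lower_def length_Suc_conv)
  then show ?case by simp
next
  case (Suc k)
  let ?x = "\<lambda>i. uea_of (X i)" and ?p = "\<lambda>is. prod_list (map (\<lambda>i. uea_of (X i)) is)"
  have "uea_contraction X (2 * Suc k + 1) T =
      (\<Sum>a\<in>UNIV. \<Sum>b\<in>UNIV. \<Sum>js\<in>indices (2 * k + 1). (T (a # b # js) *\<^sub>R (?x a * ?x b)) * ?p js)"
    by (simp add: uea_contraction_def sum_indices_Suc mult.assoc)
  also have "\<dots> = (\<Sum>js\<in>indices (2 * k + 1). \<Sum>a\<in>UNIV. \<Sum>b\<in>UNIV. (T (a # b # js) *\<^sub>R (?x a * ?x b)) * ?p js)"
    by (rule sum_rotate[symmetric])
  also have "\<dots> = (\<Sum>js\<in>indices (2 * k + 1). (1 / 2) *\<^sub>R (\<Sum>l\<in>UNIV. contr l T js *\<^sub>R ?x l) * ?p js)"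
    by (simp only: sum_distrib_right[symmetric] sum_alternating_pair[OF Suc.prems])
  also have "\<dots> = (1 / 2) *\<^sub>R (\<Sum>l\<in>UNIV. ?x l * uea_contraction X (2 * k + 1) (contr l T))"
    unfolding uea_contraction_def scaleR_sum_right sum_distrib_left sum_distrib_right
    by (subst sum.swap) simp
  also have "\<dots> = (1 / 2) ^ Suc k *\<^sub>R (\<Sum>l\<in>UNIV. ?x l * uea_contraction X (Suc k) (lower (contr l T)))"
    by (simp only: Suc.IH[OF alternating_contr[OF Suc.prems]] mult_scaleR_right scaleR_sum_right
        scaleR_scaleR power_Suc)
  also have "(\<Sum>l\<in>UNIV. ?x l * uea_contraction X (Suc k) (lower (contr l T))) =
      uea_contraction X (Suc (Suc k)) (lower T)"
    unfolding uea_contraction_Suc[of "Suc k"]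
    by (intro sum.cong refl arg_cong2[where f = "(*)"] uea_contraction_cong)
      (metis lower_Cons length_0_conv nat.distinct(1))
  finally show ?case .
qed

section \<open>The contracted cocycle as a Casimir operator\<close>

lemma casimir_operator_cocycle_of:
  assumes "invariant_tensor X (Suc k) h"
  shows "casimir_operator X (Suc k) (uea_contraction X (2 * k + 1) (cocycle_of X (Suc k) h))"
proof -
  \<comment> \<open>cut off, so that antisymmetry and invariance hold for lists of every length\<close>
  define T where "T is = (if length is = 2 * k + 1 then cocycle_of X (Suc k) h is else 0)" for "is"
  have alt: "alternating T"
    unfolding alternating_def
  proof (intro allI)
    fix u a b v
    show "T (u @ a # b # v) = - T (u @ b # a # v)"
    proof (cases "length (u @ a # b # v) = 2 * k + 1")
      case True
      then have "length (u @ b # a # v) = 2 * k + 1" by simp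
      with True show ?thesis
        unfolding T_def by (simp only: cocycle_of_eq alternation_swap[OF True, of "expand h"]) simp
    qed (simp add: T_def)
  qed
  have inv: "act x T = (\<lambda>_. 0)" for x
  proof
    fix "is"
    show "act x T is = 0"
    proof (cases "length is = 2 * k + 1")
      case True
      then have "act x T is = act x (cocycle_of X (Suc k) h) is"
        by (intro act_cong) (simp add: T_def)
      then show ?thesis using act_cocycle_of[OF assms True] by simp
    qed (simp add: act_def T_def)
  qed
  \<comment> \<open>The tensor of the Casimir operator; the factor collects one half from each of
    the \<open>k\<close> commutators.\<close>
  let ?t = "\<lambda>is. (1 / 2) ^ k * lower T is"
  have "symmetric_tensor (Suc k) ?t"
    unfolding symmetric_tensor_def
    by (auto simp: indices_def intro!: lower_mset_cong[OF alt inv] mset_permute_list)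
  moreover have "invariant_tensor X (Suc k) ?t"
  proof -
    have "act x ?t is = 0" if "is \<in> indices (Suc k)" for x "is"
    proof -
      have "is \<noteq> []" using that by (auto simp: indices_def)
      \<comment> \<open>\<open>act_sum\<close> over a one-element index set is homogeneity.\<close>
      then show ?thesis
        using act_sum[of x "\<lambda>_. (1 / 2) ^ k" "\<lambda>_. lower T" "{()}"] act_lower[OF inv] by simp
    qed
    then show ?thesis by (simp add: invariant_tensor_iff)
  qed
  moreover have "uea_contraction X (2 * k + 1) (cocycle_of X (Suc k) h) = uea_contraction X (Suc k) ?t"
  proof -
    have "uea_contraction X (2 * k + 1) (cocycle_of X (Suc k) h) = uea_contraction X (2 * k + 1) T"
      by (rule uea_contraction_cong) (simp add: T_def)
    then show ?thesis by (simp only: uea_contraction_lower[OF alt] uea_contraction_scale)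
  qed
  ultimately show ?thesis
    unfolding casimir_operator_def sym_invariant_tensor_def by blast
qed

end

theorem corollary3p3:
  fixes X :: "'n::finite \<Rightarrow> 'g::lie_algebra"
    and m :: nat
    and \<Omega> :: "'n list \<Rightarrow> real"
  assumes "compact_simple_lie_algebra TYPE('g)"
    and "lie_basis X"
    and "killing_normalised X"
    and "1 \<le> m"
    and "primitive_cocycle X m \<Omega>"
  shows "casimir_operator X m
    (\<Sum>js\<in>indices (2 * m - 1). \<Omega> js *\<^sub>R prod_list (map (\<lambda>j. uea_of (X j)) js))"
proof -
  interpret killing_normalised_basis X
    by unfold_locales (fact assms)+
  \<comment> \<open>With \<open>m = Suc k\<close> the length \<open>2 * m - 1\<close> becomes
    \<open>2 * k + 1\<close>, free of truncated subtraction.\<close>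
  obtain k where m: "m = Suc k" using \<open>1 \<le> m\<close> by (cases m) auto
  obtain h where h: "invariant_tensor X m h"
    and \<Omega>: "\<And>is. is \<in> indices (2 * m - 1) \<Longrightarrow> \<Omega> is = cocycle_of X m h is"
    using \<open>primitive_cocycle X m \<Omega>\<close>
    unfolding primitive_cocycle_def primitive_tensor_def sym_invariant_tensor_def by blast
  have "(\<Sum>js\<in>indices (2 * m - 1). \<Omega> js *\<^sub>R prod_list (map (\<lambda>j. uea_of (X j)) js)) =
      uea_contraction X (2 * k + 1) (cocycle_of X m h)"
    using \<Omega> by (simp add: uea_contraction_def m)
  then show ?thesis
    using casimir_operator_cocycle_of[of k h] h by (simp add: m)
qed

end
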